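(* Let $C\ge 2$ be an integer. For any function $h:\mathbb{Z}^+\to\mathbb{R}^+$ there exist a totally uniquely ergodic topological dynamical system $(X,T)$ (with metric $d$ on $X$) and a sequence $(q_n)$ of primes such that $$\sup_{x\in X}d(x,T^{q_n}x)=o(h(q_n))\quad\text{as } n\to\infty,$$ but for some function $f\in C(X)$ and some point $x\in X$ the limit $$\lim_{n\to\infty}\frac1n\sum_{0\le i<n}f\big(T^{i^C}x\big)$$ does not exist.
   Context: A topological dynamical system is a pair $(X,T)$ with $X$ a compact metric space and $T:X\to X$ a homeomorphism. It is uniquely ergodic if there is exactly one $T$-invariant Borel probability measure on $X$, and totally uniquely ergodic if $(X,T^n)$ is uniquely ergodic for every positive integer $n$. $\mathbb{R}^+$ denotes the positive reals. *)

theory Defs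
  imports
    "HOL-Probability.Probability"
    "HOL-Library.Landau_Symbols"
    "HOL-Computational_Algebra.Primes"
begin

definition topological_dynamical_system :: "'a metric \<Rightarrow> ('a \<Rightarrow> 'a) \<Rightarrow> bool" where
  "topological_dynamical_system X T \<longleftrightarrow>
     compact_space (mtopology_of X) \<and>
     homeomorphic_map (mtopology_of X) (mtopology_of X) T"

definition borel_of_metric :: "'a metric \<Rightarrow> 'a measure" where
  "borel_of_metric X = sigma (mspace X) {U. openin (mtopology_of X) U}"

definition invariant_borel_prob :: "'a metric \<Rightarrow> ('a \<Rightarrow> 'a) \<Rightarrow> 'a measure \<Rightarrow> bool" where
  "invariant_borel_prob X T \<mu> \<longleftrightarrow>
     sets \<mu> = sets (borel_of_metric X) \<and>
     prob_space \<mu> \<and>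
     (\<forall>A\<in>sets \<mu>. emeasure \<mu> (T -` A \<inter> space \<mu>) = emeasure \<mu> A)"

definition uniquely_ergodic :: "'a metric \<Rightarrow> ('a \<Rightarrow> 'a) \<Rightarrow> bool" where
  "uniquely_ergodic X T \<longleftrightarrow> (\<exists>!\<mu>. invariant_borel_prob X T \<mu>)"

definition totally_uniquely_ergodic :: "'a metric \<Rightarrow> ('a \<Rightarrow> 'a) \<Rightarrow> bool" where
  "totally_uniquely_ergodic X T \<longleftrightarrow> (\<forall>n>0. uniquely_ergodic X (T ^^ n))"

end

theory Submission
  imports Defs
begin

text \<open>
  The system is a shift-invariant compact set of functions \<open>\<int> \<rightarrow> [0,1]\<close> whose elements have arbitrarily
  small mean over all sufficiently long windows; hence for every power of the shift the point mass
  at the zero function is the only invariant measure.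

  It must contain a point \<open>x\<close> whose averages along \<open>i\<^sup>C\<close> oscillate and that is nearly
  \<open>q\<^sub>k\<close>-periodic, uniformly. Give \<open>\<int>\<close> the word length in which the
  generator \<open>q\<^sub>k\<close> has length \<open>1/J\<^sub>k\<close>, and let \<open>x(m) = max(0, 1 - d(m, A))\<close>, where \<open>A\<close> consists of the powers
  \<open>i\<^sup>C\<close> with \<open>i\<close> in sparse blocks \<open>[a\<^sub>k, 2a\<^sub>k)\<close>. This is 1-Lipschitz, so translation by
  \<open>q\<^sub>k\<close> moves it by at most \<open>1/J\<^sub>k\<close>; it is 1 on \<open>A\<close>, so the average up to \<open>2a\<^sub>k\<close> is at least 1/2.
  If the scales \<open>a\<^sub>0, q\<^sub>0, J\<^sub>0, a\<^sub>1, \<dots>\<close> are chosen one after the other, growing fast enough, then the support of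
  \<open>x\<close> has Banach density 0, and it meets few \<open>i\<^sup>C\<close> with \<open>i < a\<^sub>k\<close>, so that the average up to \<open>a\<^sub>k\<close> is at
  most 1/4. The freedom in choosing \<open>q\<^sub>k\<close> lets it be prime, and \<open>J\<^sub>k\<close> is chosen after it, hence in terms of \<open>h(q\<^sub>k)\<close>.
\<close>

section \<open>Shift spaces of functions on the integers\<close>

definition left_shift :: "(int \<Rightarrow> real) \<Rightarrow> (int \<Rightarrow> real)" where
  "left_shift y = (\<lambda>i. y (i + 1))"

lemma funpow_left_shift: "(left_shift ^^ n) y = (\<lambda>i. y (i + int n))"
  by (induction n) (auto simp: left_shift_def fun_eq_iff algebra_simps)

lemma continuous_on_translate_coordinates:
  "continuous_on A (\<lambda>(y :: int \<Rightarrow> real) i. y (i + k))"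
  by (rule continuous_on_coordinatewise_then_product)
    (rule continuous_on_subset[OF continuous_on_product_coordinates], simp)

lemma topological_dynamical_system_shift:
  fixes S :: "(int \<Rightarrow> real) set"
  assumes "compact S" and inv: "\<And>y k. y \<in> S \<Longrightarrow> (\<lambda>i. y (i + k)) \<in> S"
  shows "topological_dynamical_system (submetric euclidean_metric S) left_shift"
proof -
  have cont: "continuous_map (top_of_set S) (top_of_set S) (\<lambda>y i. y (i + k))" for k :: int
    using inv continuous_on_translate_coordinates by (auto simp: continuous_map_in_subtopology)
  have "homeomorphic_maps (top_of_set S) (top_of_set S) left_shift (\<lambda>y i. y (i + (-1)))"
    unfolding homeomorphic_maps_def using cont[of 1] cont[of "-1"]
    by (simp add: left_shift_def[abs_def])
  then have "homeomorphic_map (top_of_set S) (top_of_set S) left_shift"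
    using homeomorphic_map_maps by blast
  then show ?thesis
    using assms(1) unfolding topological_dynamical_system_def mtopology_of_submetric mtopology_of_euclidean
    by (simp add: compact_space_subtopology)
qed

text \<open>The metric on the function space sums truncated coordinate distances with weights
  \<open>(1/2)^n\<close>, and these add up to 2.\<close>

lemma dist_fun_le:
  fixes x y :: "int \<Rightarrow> real"
  assumes "\<And>i. \<bar>x i - y i\<bar> \<le> e"
  shows "dist x y \<le> 2 * e"
proof -
  have s: "summable (\<lambda>n. (1/2)^n * e)"
    by (intro summable_mult2 summable_geometric) simp
  have le: "(1/2)^n * min (dist (x (from_nat n)) (y (from_nat n))) 1 \<le> (1/2)^n * e" for n
    using assms[of "from_nat n"] by (intro mult_left_mono) (auto simp: dist_real_def)
  have "dist x y \<le> (\<Sum>n. (1/2)^n * e)"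
    unfolding dist_fun_def
    by (rule suminf_le[OF le _ s], rule summable_comparison_test'[OF s]) (use le in auto)
  also have "\<dots> = 2 * e"
    using suminf_mult2[of "\<lambda>n. (1/2::real)^n" e] suminf_geometric[of "1/2::real"]
    by (simp add: summable_geometric)
  finally show ?thesis .
qed

lemma sum_blocks_le:
  fixes y :: "int \<Rightarrow> real"
  assumes "\<And>m. (\<Sum>i<D. y (m + int i)) \<le> b"
  shows "(\<Sum>i<n * D. y (m + int i)) \<le> real n * b"
proof (induction n)
  case (Suc n)
  have "(\<Sum>i<Suc n * D. y (m + int i)) =
      (\<Sum>i<n * D. y (m + int i)) + (\<Sum>i\<in>{n * D..<n * D + D}. y (m + int i))"
    using sum.atLeastLessThan_concat[of 0 "n * D" "n * D + D" "\<lambda>i. y (m + int i)"]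
    by (simp add: lessThan_atLeast0 add.commute)
  also have "(\<Sum>i\<in>{n * D..<n * D + D}. y (m + int i)) = (\<Sum>i<D. y ((m + int (n * D)) + int i))"
    using sum.shift_bounds_nat_ivl[of "\<lambda>i. y (m + int i)" 0 "n * D" D]
    by (simp add: lessThan_atLeast0 algebra_simps)
  also have "(\<Sum>i<n * D. y (m + int i)) + \<dots> \<le> real n * b + b"
    by (intro add_mono Suc assms)
  finally show ?case by (simp add: algebra_simps)
qed simp

text \<open>A window of length \<open>n * D\<close> contains \<open>D\<close> multiples of
  \<open>n\<close>; the other terms are nonnegative, and the window splits into \<open>n\<close>
  blocks of length \<open>D\<close>.\<close>

lemma sum_multiples_le:
  fixes y :: "int \<Rightarrow> real"
  assumes nonneg: "\<And>i. 0 \<le> y i" and "n > 0"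
    and "\<And>m. (\<Sum>i<D. y (m + int i)) \<le> b"
  shows "(\<Sum>i<D. y (int (n * i))) \<le> real n * b"
proof -
  have "(\<Sum>i<D. y (int (n * i))) = (\<Sum>i\<in>(*) n ` {..<D}. y (int i))"
    using \<open>n > 0\<close> by (simp add: sum.reindex inj_on_def)
  also have "\<dots> \<le> (\<Sum>i<n * D. y (0 + int i))"
    using \<open>n > 0\<close> by (simp, intro sum_mono2) (auto intro: nonneg)
  also have "\<dots> \<le> real n * b"
    by (rule sum_blocks_le) fact
  finally show ?thesis .
qed

text \<open>For a measure invariant under the \<open>n\<close>-th power, all coordinates
  \<open>i + n * j\<close> have the same integral. Averaging over \<open>D\<close> of them and using
  the density bound shows that this integral is 0, so the measure sits on the zero function.\<close>

lemma totally_uniquely_ergodic_shift: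
  fixes S :: "(int \<Rightarrow> real) set"
  assumes inv: "\<And>y k. y \<in> S \<Longrightarrow> (\<lambda>i. y (i + k)) \<in> S"
    and zero: "(\<lambda>_. 0) \<in> S"
    and bds: "\<And>y i. y \<in> S \<Longrightarrow> 0 \<le> y i \<and> y i \<le> 1"
    and density: "\<And>e. e > 0 \<Longrightarrow> \<exists>D>0. \<forall>y\<in>S. (\<Sum>i<D. y (int i)) \<le> e * real D"
  shows "totally_uniquely_ergodic (submetric euclidean_metric S) left_shift"
  unfolding totally_uniquely_ergodic_def uniquely_ergodic_def
proof (intro allI impI)
  fix n :: nat
  assume "n > 0"
  let ?X = "submetric euclidean_metric S"
  let ?B = "borel_of_metric ?X"
  let ?T = "left_shift ^^ n"
  let ?z = "(\<lambda>_. 0) :: int \<Rightarrow> real"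
  have space_B: "space ?B = S"
    by (simp add: borel_of_metric_def space_measure_of_conv)
  have sets_B: "sets ?B = sigma_sets S {U. openin (top_of_set S) U}"
    unfolding borel_of_metric_def mtopology_of_submetric mtopology_of_euclidean
    by (subst sets_measure_of) (auto dest: openin_imp_subset)
  have openB: "U \<in> sets ?B" if "openin (top_of_set S) U" for U
    using that unfolding sets_B by auto
  have T_S: "?T y \<in> S" if "y \<in> S" for y
    using inv[OF that, of "int n"] by (simp add: funpow_left_shift)
  have T_meas: "?T \<in> measurable ?B ?B"
  proof (rule measurable_sigma_sets[OF sets_B])
    fix U assume U: "U \<in> {U. openin (top_of_set S) U}"
    have "continuous_map (top_of_set S) (top_of_set S) ?T"
      using T_S continuous_on_translate_coordinates[of S "int n"]
      by (auto simp: continuous_map_in_subtopology funpow_left_shift[abs_def])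
    then show "?T -` U \<inter> space ?B \<in> sets ?B"
      using U openin_continuous_map_preimage[of "top_of_set S" "top_of_set S" ?T U]
      by (intro openB) (simp add: space_B vimage_def Int_def conj_commute)
  qed (auto simp: space_B T_S dest: openin_imp_subset)
  have coord: "(\<lambda>y. y i) \<in> borel_measurable ?B" for i
  proof (rule borel_measurableI)
    fix U :: "real set" assume "open U"
    then have "openin (top_of_set S) (S \<inter> (\<lambda>y. y i) -` U)"
      by (intro continuous_openin_preimage_gen)
        (auto intro: continuous_on_subset[OF continuous_on_product_coordinates])
    then show "(\<lambda>y. y i) -` U \<inter> space ?B \<in> sets ?B"
      by (intro openB) (simp add: space_B Int_commute)
  qed
  show "\<exists>!\<mu>. invariant_borel_prob ?X ?T \<mu>"
  proof (rule ex1I)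
    show "invariant_borel_prob ?X ?T (return ?B ?z)"
      unfolding invariant_borel_prob_def
    proof (intro conjI ballI)
      show "prob_space (return ?B ?z)"
        by (rule prob_space_return) (simp add: space_B zero)
      fix A assume A: "A \<in> sets (return ?B ?z)"
      then have "?T -` A \<inter> space ?B \<in> sets ?B"
        using T_meas by (auto intro: measurable_sets)
      then show "emeasure (return ?B ?z) (?T -` A \<inter> space (return ?B ?z)) = emeasure (return ?B ?z) A"
        using A zero by (simp add: space_B funpow_left_shift indicator_def)
    qed simp
  next
    fix \<mu> assume \<mu>: "invariant_borel_prob ?X ?T \<mu>"
    then have sets_eq: "sets \<mu> = sets ?B"
      and emeas: "\<And>A. A \<in> sets \<mu> \<Longrightarrow> emeasure \<mu> (?T -` A \<inter> space \<mu>) = emeasure \<mu> A"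
      unfolding invariant_borel_prob_def by auto
    interpret prob_space \<mu> using \<mu> by (simp add: invariant_borel_prob_def)
    have space_eq: "space \<mu> = S" using sets_eq_imp_space_eq[OF sets_eq] space_B by simp
    have T_meas': "?T \<in> measurable \<mu> \<mu>"
      using T_meas measurable_cong_sets[OF sets_eq sets_eq] by simp
    have coord': "(\<lambda>y. y i) \<in> borel_measurable \<mu>" for i
      using coord measurable_cong_sets[OF sets_eq refl] by blast
    have int: "integrable \<mu> (\<lambda>y. y i)" for i
      by (rule integrable_const_bound[where B=1]) (auto simp: coord' space_eq bds)
    have distr: "distr \<mu> \<mu> ?T = \<mu>"
      by (rule measure_eqI) (auto simp: emeasure_distr T_meas' emeas)
    have shift_int: "(\<integral>y. y (i + int n) \<partial>\<mu>) = (\<integral>y. y i \<partial>\<mu>)" for i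
    proof -
      have "(\<integral>y. y i \<partial>\<mu>) = (\<integral>y. y i \<partial>distr \<mu> \<mu> ?T)" by (simp add: distr)
      also have "\<dots> = (\<integral>y. ?T y i \<partial>\<mu>)"
        by (rule integral_distr[OF T_meas' coord'])
      finally show ?thesis by (simp add: funpow_left_shift)
    qed
    have mult_int: "(\<integral>y. y (i + int (n * j)) \<partial>\<mu>) = (\<integral>y. y i \<partial>\<mu>)" for i j
    proof (induction j)
      case (Suc j)
      then show ?case using shift_int[of "i + int (n * j)"] by (simp add: algebra_simps)
    qed simp
    have "(\<integral>y. y i \<partial>\<mu>) \<le> e" if "e > 0" for e i
    proof -
      \<comment> \<open>\<open>sum_multiples_le\<close> loses a factor \<open>n\<close>, so the
        density is taken at \<open>e / real n\<close>.\<close>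
      obtain D where "D > 0" and D: "\<And>y. y \<in> S \<Longrightarrow> (\<Sum>i<D. y (int i)) \<le> e / real n * real D"
        using density[of "e / real n"] \<open>e > 0\<close> \<open>n > 0\<close> by auto
      have le: "(\<Sum>j<D. y (i + int (n * j))) \<le> e * real D" if "y \<in> S" for y
      proof -
        have win: "(\<Sum>j<D. y (i + (m + int j))) \<le> e / real n * real D" for m
          using D[OF inv[OF that, of "i + m"]] by (simp add: add.commute add.left_commute)
        have "(\<Sum>j<D. (\<lambda>k. y (i + k)) (int (n * j))) \<le> real n * (e / real n * real D)"
          using bds[OF that] \<open>n > 0\<close> win by (intro sum_multiples_le) auto
        then show ?thesis using \<open>n > 0\<close> by simp
      qed
      have "real D * (\<integral>y. y i \<partial>\<mu>) = (\<Sum>j<D. (\<integral>y. y (i + int (n * j)) \<partial>\<mu>))"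
        by (simp only: mult_int) simp
      also have "\<dots> = (\<integral>y. (\<Sum>j<D. y (i + int (n * j))) \<partial>\<mu>)"
        by (simp add: int)
      also have "\<dots> \<le> (\<integral>y. e * real D \<partial>\<mu>)"
        by (rule integral_mono) (auto simp: int le space_eq simp del: of_nat_mult)
      also have "\<dots> = real D * e" by (simp add: prob_space)
      finally show ?thesis using \<open>D > 0\<close> by simp
    qed
    then have "(\<integral>y. y i \<partial>\<mu>) \<le> 0" for i by (meson dense_ge)
    moreover have "(\<integral>y. y i \<partial>\<mu>) \<ge> 0" for i
      by (rule integral_nonneg_AE) (auto simp: space_eq bds)
    ultimately have "(\<integral>y. y i \<partial>\<mu>) = 0" for i by (simp add: order_antisym)
    moreover have "AE y in \<mu>. 0 \<le> y i" for i by (rule AE_I2) (simp add: space_eq bds)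
    ultimately have "AE y in \<mu>. y i = 0" for i
      using integral_nonneg_eq_0_iff_AE[OF int[of i]] by blast
    then have "AE y in \<mu>. \<forall>i. y i = 0" by (simp add: AE_all_countable)
    then have AE0: "AE y in \<mu>. y = ?z" by (simp add: fun_eq_iff)
    show "\<mu> = return ?B ?z"
    proof (rule measure_eqI)
      fix A assume A: "A \<in> sets \<mu>"
      have "emeasure \<mu> A = (\<integral>\<^sup>+y. indicator A y \<partial>\<mu>)" using A by simp
      also have "\<dots> = (\<integral>\<^sup>+y. indicator A ?z \<partial>\<mu>)"
        using AE0 by (intro nn_integral_cong_AE) auto
      also have "\<dots> = indicator A ?z" by (simp add: emeasure_space_1)
      finally show "emeasure \<mu> A = emeasure (return ?B ?z) A"
        using A sets_eq by simp
    qed (simp add: sets_eq)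
  qed
qed

section \<open>Scales and combinations of the generators\<close>

lemma power_diff_ge:
  fixes p p' :: nat
  assumes "2 \<le> C" "p < p'"
  shows "int p ^ C + int p' \<le> int p' ^ C"
proof -
  obtain c where c: "C = Suc (Suc c)"
    using \<open>2 \<le> C\<close> by (metis add_2_eq_Suc le_Suc_ex)
  \<comment> \<open>With \<open>r = p' ^ (C - 1)\<close>,
    \<open>p ^ C \<le> p * r \<le> p' * r - r\<close>, and \<open>p' \<le> r\<close> because
    \<open>C \<ge> 2\<close>.\<close>
  define r where "r = p' ^ Suc c"
  have "p ^ C \<le> p * r"
    unfolding c r_def power_Suc[of p "Suc c"] using assms(2) by (intro mult_left_mono power_mono) auto
  moreover have "p' \<le> r"
    unfolding r_def by (rule self_le_power) (use assms(2) in auto)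
  moreover have "(p + 1) * r \<le> p' * r"
    using assms(2) by (intro mult_right_mono) auto
  moreover have "p' ^ C = p' * r" by (simp add: c r_def)
  ultimately have "p ^ C + p' \<le> p' ^ C"
    by (simp add: add_mult_distrib)
  then show ?thesis by (metis of_nat_add of_nat_le_iff of_nat_power)
qed

text \<open>\<open>M k\<close> bounds what was chosen before stage \<open>k\<close>. The support of the point to be built is covered by
  \<open>4 * M k + 1\<close> translates of a set with gaps at least \<open>D k\<close>, so its Banach density is at most
  \<open>(4 * M k + 1) / D k\<close>.\<close>

locale scales =
  fixes C :: nat and a q J M D :: "nat \<Rightarrow> nat"
  assumes C_ge: "2 \<le> C"
    and J_pos: "0 < J k"
    and D_mono: "D k \<le> D (Suc k)"
    and D_ge: "(k + 8) * (4 * M k + 1) \<le> D k"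
    and a_ge: "2 * M k + D k \<le> a k"
    and q_ge: "(2 * a k) ^ C + 2 * M k + D k \<le> q k"
    and M_ge: "M k + J k * q k + (2 * a k) ^ C \<le> M (Suc k)"
begin

lemma D_pos: "0 < D k"
  using D_ge[of k] by (cases "D k") auto

lemma D_le: "k \<le> l \<Longrightarrow> D k \<le> D l"
  by (rule lift_Suc_mono_le[of D, OF D_mono])

lemma M_le: "k \<le> l \<Longrightarrow> M k \<le> M l"
proof (rule lift_Suc_mono_le[of M])
  show "M n \<le> M (Suc n)" for n using M_ge[of n] by linarith
qed

lemma power_block_le_M: "l < k \<Longrightarrow> (2 * a l) ^ C \<le> M k"
  using M_ge[of l] M_le[of "Suc l" k] by simp

lemma le_power_C: "p \<le> p ^ C" for p :: nat
  using C_ge self_le_power[of p C] by (cases "p = 0") simp_all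

lemma a_le: "k \<le> l \<Longrightarrow> a k \<le> a l"
proof (rule lift_Suc_mono_le[of a])
  fix n
  have "2 * a n \<le> (2 * a n) ^ C" by (rule le_power_C)
  also have "\<dots> \<le> M (Suc n)" using power_block_le_M by blast
  also have "\<dots> \<le> a (Suc n)" using a_ge[of "Suc n"] by simp
  finally show "a n \<le> a (Suc n)" by simp
qed

definition comb :: "(nat \<Rightarrow> int) \<Rightarrow> nat \<Rightarrow> int" where
  "comb c K = (\<Sum>j<K. c j * int (q j))"

lemma comb_extend: "(\<And>j. K \<le> j \<Longrightarrow> c j = 0) \<Longrightarrow> K \<le> L \<Longrightarrow> comb c L = comb c K"
  unfolding comb_def by (rule sum.mono_neutral_right) auto

lemma comb_diff: "comb c K - comb c' K = comb (\<lambda>j. c j - c' j) K"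
  by (simp add: comb_def sum_subtractf left_diff_distrib)

lemma comb_uminus: "comb (\<lambda>j. - c j) K = - comb c K"
  by (simp add: comb_def sum_negf)

text \<open>The term of index \<open>K\<close> is at most \<open>b * J K * q K\<close>, which
  \<open>M (Suc K)\<close> absorbs on top of \<open>M K\<close>. A single representation uses
  \<open>b = 1\<close>, a difference of two uses \<open>b = 2\<close>.\<close>

lemma abs_comb_le:
  assumes "\<And>j. j < K \<Longrightarrow> \<bar>c j\<bar> \<le> int (b * J j)"
  shows "\<bar>comb c K\<bar> \<le> int (b * M K)"
  using assms
proof (induction K)
  case 0
  then show ?case by (simp add: comb_def)
next
  case (Suc K)
  have "\<bar>comb c (Suc K)\<bar> \<le> \<bar>comb c K\<bar> + \<bar>c K * int (q K)\<bar>"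
    by (simp add: comb_def)
  also have "\<bar>comb c K\<bar> \<le> int (b * M K)" using Suc by simp
  also have "\<bar>c K * int (q K)\<bar> \<le> int (b * J K) * int (q K)"
    using Suc.prems[of K] unfolding abs_mult by (intro mult_mono) auto
  also have "int (b * M K) + int (b * J K) * int (q K) = int (b * (M K + J K * q K))"
    by (simp add: algebra_simps)
  also have "\<dots> \<le> int (b * M (Suc K))"
    using M_ge[of K] by (intro of_nat_mono mult_left_mono) auto
  finally show ?case by simp
qed

text \<open>The leading scale \<^term>\<open>j\<close> decides: a difference of powers from blocks up to \<^term>\<open>j\<close> is
  too small to compensate \<^term>\<open>q j\<close>, one that involves a later block is too large.\<close>

lemma leading_term_dominates:
  assumes top: "c j \<noteq> 0" "\<And>i. j < i \<Longrightarrow> c i = 0" and "j < K"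
    and c: "\<And>i. \<bar>c i\<bar> \<le> int (2 * J i)"
    and p: "p < 2 * a j \<or> a (Suc j) \<le> p" and p': "p' < 2 * a j \<or> a (Suc j) \<le> p'"
  shows "int (D j) \<le> \<bar>int p' ^ C - int p ^ C + comb c K\<bar>"
  using p p' top c
proof (induction p p' arbitrary: c rule: linorder_wlog)
  \<comment> \<open>Exchanging \<open>p\<close> and \<open>p'\<close> and negating \<open>c\<close>
    only changes the sign of the expression.\<close>
  case (sym p p' c)
  show ?case
    using sym(1)[of "\<lambda>i. - c i"] sym(2-) by (simp add: comb_uminus)
next
  case (le p p' c)
  have cut: "comb c K = comb c (Suc j)"
    using \<open>j < K\<close> le(5) by (intro comb_extend) auto
  show ?case
  \<comment> \<open>If \<open>p = p'\<close>, the powers cancel even in a late block, so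
    \<open>q j\<close> dominates as in the early case.\<close>
  proof (cases "p' < 2 * a j \<or> p = p'")
    case True
    have "int p' ^ C - int p ^ C \<le> int ((2 * a j) ^ C)"
    proof (cases "p = p'")
      case False
      with True have "p' ^ C \<le> (2 * a j) ^ C" by (intro power_mono) auto
      then have "int p' ^ C \<le> int ((2 * a j) ^ C)" by (metis of_nat_le_iff of_nat_power)
      moreover have "0 \<le> int p ^ C" by simp
      ultimately show ?thesis by linarith
    qed simp
    moreover have "0 \<le> int p' ^ C - int p ^ C" using le(1) by (simp add: power_mono)
    moreover have "int (q j) \<le> \<bar>c j * int (q j)\<bar>"
      using mult_right_mono[of 1 "\<bar>c j\<bar>" "int (q j)"] le(4) by (simp add: abs_mult)
    moreover have "comb c K = comb c j + c j * int (q j)" unfolding cut by (simp add: comb_def)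
    moreover have "\<bar>comb c j\<bar> \<le> int (2 * M j)" by (rule abs_comb_le) (rule le(6))
    moreover have "int ((2 * a j) ^ C) + int (2 * M j) + int (D j) \<le> int (q j)"
      using q_ge[of j] by (metis of_nat_add of_nat_le_iff)
    ultimately show ?thesis by linarith
  next
    case False
    \<comment> \<open>The gap between the powers is at least \<open>p'\<close>, hence at least
      \<open>a (Suc j)\<close>, which exceeds the bound \<open>2 * M (Suc j)\<close> on the
      combination by at least \<open>D (Suc j)\<close>.\<close>
    then have "p < p'" and p': "a (Suc j) \<le> p'" using le(1-3) by auto
    have "\<bar>comb c K\<bar> \<le> int (2 * M (Suc j))"
      unfolding cut by (rule abs_comb_le) (rule le(6))
    moreover have "int p ^ C + int p' \<le> int p' ^ C" by (rule power_diff_ge[OF C_ge \<open>p < p'\<close>])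
    moreover have "2 * M (Suc j) + D j \<le> p'"
      using p' a_ge[of "Suc j"] D_mono[of j] by linarith
    ultimately show ?thesis by linarith
  qed
qed

lemma obtain_leading_term:
  fixes c :: "nat \<Rightarrow> int"
  assumes "c i \<noteq> 0" "\<And>j. K \<le> j \<Longrightarrow> c j = 0"
  obtains j where "i \<le> j" "j < K" "c j \<noteq> 0" "\<And>i. j < i \<Longrightarrow> c i = 0"
proof -
  let ?j = "Max {j. c j \<noteq> 0}"
  have sub: "{j. c j \<noteq> 0} \<subseteq> {..<K}" using assms(2) not_le by auto
  then have fin: "finite {j. c j \<noteq> 0}" using finite_subset by blast
  have "?j \<in> {j. c j \<noteq> 0}" using fin assms(1) by (intro Max_in) auto
  then have "c ?j \<noteq> 0" "?j < K" using sub by blast+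
  moreover have "i \<le> ?j" using fin assms(1) by (intro Max_ge) auto
  moreover have "c i = 0" if "?j < i" for i
  proof (rule ccontr)
    assume "c i \<noteq> 0"
    then have "i \<le> ?j" using fin by (intro Max_ge) auto
    then show False using that by simp
  qed
  ultimately show thesis by (intro that[of ?j])
qed

section \<open>The point and its translates by the generators\<close>

definition block :: "nat \<Rightarrow> nat set" where
  "block l = {a l..<2 * a l}"

text \<open>Monotonicity of \<open>a\<close> decides the side, according to whether
  \<open>l \<le> j\<close>; this supplies the hypotheses on \<open>p\<close> and \<open>p'\<close>
  in \<open>leading_term_dominates\<close>.\<close>

lemma block_dichotomy: "p \<in> block l \<Longrightarrow> p < 2 * a j \<or> a (Suc j) \<le> p"
  using a_le[of l j] a_le[of "Suc j" l] by (cases "l \<le> j") (auto simp: block_def)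

definition represents :: "int \<Rightarrow> nat \<Rightarrow> (nat \<Rightarrow> int) \<Rightarrow> nat \<Rightarrow> bool" where
  "represents m p c K \<longleftrightarrow> p \<in> (\<Union>l. block l) \<and> (\<forall>j\<ge>K. c j = 0) \<and> m = int p ^ C + comb c K"

definition weights :: "int \<Rightarrow> real set" where
  "weights m = {1 - (\<Sum>j<K. \<bar>real_of_int (c j)\<bar> / real (J j)) | p c K. represents m p c K}"

text \<open>With generators \<^term>\<open>q j\<close> of length \<open>1 / J j\<close>, this is one minus the word distance from
  \<^term>\<open>m\<close> to the \<^term>\<open>C\<close>-th powers of the elements of the blocks, cut off at zero.\<close>

definition pt :: "int \<Rightarrow> real" where
  "pt m = Sup (insert 0 (weights m))"

lemma weights_le_1: "t \<in> weights m \<Longrightarrow> t \<le> 1"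
  by (auto simp: weights_def sum_nonneg)

lemma bdd_weights: "bdd_above (insert 0 (weights m))"
  by (rule bdd_aboveI[of _ 1]) (use weights_le_1[of _ m] in auto)

lemma pt_nonneg: "0 \<le> pt m"
  unfolding pt_def by (rule cSup_upper[OF _ bdd_weights]) simp

lemma weights_le_pt: "t \<in> weights m \<Longrightarrow> t \<le> pt m"
  unfolding pt_def by (rule cSup_upper[OF _ bdd_weights]) simp

lemma pt_leI: "0 \<le> b \<Longrightarrow> (\<And>t. t \<in> weights m \<Longrightarrow> t \<le> b) \<Longrightarrow> pt m \<le> b"
  unfolding pt_def by (rule cSup_least) auto

lemma pt_le_1: "pt m \<le> 1"
  by (rule pt_leI) (use weights_le_1[of _ m] in auto)

lemma pt_power_block:
  assumes "p \<in> block l"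
  shows "pt (int p ^ C) = 1"
proof (rule antisym[OF pt_le_1])
  have "represents (int p ^ C) p (\<lambda>_. 0) 0"
    using assms by (auto simp: represents_def comb_def)
  then have "1 \<in> weights (int p ^ C)"
    unfolding weights_def by force
  then show "1 \<le> pt (int p ^ C)" by (rule weights_le_pt)
qed

text \<open>A positive weight leaves every single quotient \<open>\<bar>c j\<bar> / J j\<close>
  below 1. The separation arguments need this bound on the coefficients.\<close>

lemma pt_pos_represents:
  assumes "0 < pt m"
  obtains p c K where "represents m p c K" "\<And>j. \<bar>c j\<bar> \<le> int (J j)"
proof -
  obtain t where "t \<in> insert 0 (weights m)" "0 < t"
    using assms less_cSup_iff[OF _ bdd_weights[of m], of 0] unfolding pt_def by auto
  then obtain p c K where rep: "represents m p c K"
    and pos: "0 < 1 - (\<Sum>j<K. \<bar>real_of_int (c j)\<bar> / real (J j))"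
    unfolding weights_def by auto
  have "\<bar>c j\<bar> \<le> int (J j)" for j
  proof (cases "j < K")
    case True
    have "\<bar>real_of_int (c j)\<bar> / real (J j) \<le> (\<Sum>j<K. \<bar>real_of_int (c j)\<bar> / real (J j))"
      using True by (intro member_le_sum) auto
    then have "\<bar>real_of_int (c j)\<bar> / real (J j) < 1" using pos by linarith
    then have "\<bar>real_of_int (c j)\<bar> < real (J j)" using J_pos[of j] by simp
    then show ?thesis by linarith
  next
    case False
    then show ?thesis using rep by (simp add: represents_def)
  qed
  then show thesis using that rep by blast
qed

text \<open>Changing coefficient \<open>j\<close> by \<open>s\<close> turns a representation of
  \<open>m\<close> into one of \<open>m + s * int (q j)\<close> and lowers its weight by at most
  \<open>1 / real (J j)\<close>.\<close>

lemma pt_translate_ge: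
  assumes "\<bar>s\<bar> = 1"
  shows "pt m - 1 / real (J j) \<le> pt (m + s * int (q j))"
proof -
  have "pt m \<le> pt (m + s * int (q j)) + 1 / real (J j)"
  proof (rule pt_leI)
    show "0 \<le> pt (m + s * int (q j)) + 1 / real (J j)" using pt_nonneg by simp
    fix t assume "t \<in> weights m"
    then obtain p c K where rep: "represents m p c K"
      and t: "t = 1 - (\<Sum>j<K. \<bar>real_of_int (c j)\<bar> / real (J j))"
      unfolding weights_def by auto
    define L where "L = max K (Suc j)"
    have L: "K \<le> L" "j < L" by (auto simp: L_def)
    define c' where "c' = c(j := c j + s)"
    have zero: "c i = 0" if "K \<le> i" for i using rep that by (simp add: represents_def)
    have "comb c' L = comb c L + s * int (q j)"
      using L(2) unfolding comb_def c'_def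
      by (simp add: sum.remove[of "{..<L}" j] algebra_simps)
    moreover have "comb c L = comb c K" using zero L(1) by (rule comb_extend)
    ultimately have "represents (m + s * int (q j)) p c' L"
      using rep L by (auto simp: represents_def c'_def)
    then have "1 - (\<Sum>i<L. \<bar>real_of_int (c' i)\<bar> / real (J i)) \<in> weights (m + s * int (q j))"
      unfolding weights_def by blast
    then have "1 - (\<Sum>i<L. \<bar>real_of_int (c' i)\<bar> / real (J i)) \<le> pt (m + s * int (q j))"
      by (rule weights_le_pt)
    moreover have "(\<Sum>i<L. \<bar>real_of_int (c' i)\<bar> / real (J i)) \<le>
        (\<Sum>i<L. \<bar>real_of_int (c i)\<bar> / real (J i)) + 1 / real (J j)"
    proof -
      have "real_of_int \<bar>c j + s\<bar> \<le> real_of_int (\<bar>c j\<bar> + 1)"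
        using assms by linarith
      then have "\<bar>real_of_int (c j + s)\<bar> / real (J j) \<le> (\<bar>real_of_int (c j)\<bar> + 1) / real (J j)"
        by (intro divide_right_mono) auto
      then show ?thesis
        using L(2) by (simp add: c'_def sum.remove[of "{..<L}" j] add_divide_distrib)
    qed
    moreover have "(\<Sum>i<L. \<bar>real_of_int (c i)\<bar> / real (J i)) = (\<Sum>i<K. \<bar>real_of_int (c i)\<bar> / real (J i))"
      using zero L(1) by (intro sum.mono_neutral_right) auto
    ultimately show "t \<le> pt (m + s * int (q j)) + 1 / real (J j)" unfolding t by linarith
  qed
  then show ?thesis by simp
qed

lemma pt_translate: "\<bar>pt (m + int (q j)) - pt m\<bar> \<le> 1 / real (J j)"
  using pt_translate_ge[of 1 m j] pt_translate_ge[of "-1" "m + int (q j)" j] by simp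

section \<open>Banach density of the support\<close>

lemma separated:
  assumes c: "\<And>j. \<bar>c j\<bar> \<le> int (2 * J j)" "\<And>j. j < k \<Longrightarrow> c j = 0" "\<And>j. K \<le> j \<Longrightarrow> c j = 0"
    and p: "p = 0 \<or> (\<exists>l\<ge>k. p \<in> block l)" and p': "p' = 0 \<or> (\<exists>l\<ge>k. p' \<in> block l)"
    and ne: "int p' ^ C - int p ^ C + comb c K \<noteq> 0"
  shows "int (D k) \<le> \<bar>int p' ^ C - int p ^ C + comb c K\<bar>"
proof (cases "\<forall>j. c j = 0")
  case True
  then have comb0: "comb c K = 0" by (simp add: comb_def)
  \<comment> \<open>Only powers remain: the larger base lies in a block of index at least
    \<open>k\<close>, so it is at least \<open>D k\<close>, and the gap between the powers is no
    smaller than that base.\<close>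
  have large: "int (D k) \<le> int s ^ C - int r ^ C" if "r < s" "s = 0 \<or> (\<exists>l\<ge>k. s \<in> block l)" for r s
  proof -
    obtain l where "k \<le> l" "a l \<le> s" using \<open>r < s\<close> \<open>s = 0 \<or> _\<close> by (auto simp: block_def)
    then have "D k \<le> s" using D_le[of k l] a_ge[of l] by linarith
    then show ?thesis using power_diff_ge[OF C_ge \<open>r < s\<close>] by linarith
  qed
  have "p \<noteq> p'" using ne comb0 by auto
  then show ?thesis using large[of p p'] large[of p' p] p p' comb0 by (cases p p' rule: linorder_cases) auto
next
  case False
  then obtain i where i: "c i \<noteq> 0" by blast
  then obtain j where j: "i \<le> j" "j < K" "c j \<noteq> 0" "\<And>i. j < i \<Longrightarrow> c i = 0"
    using obtain_leading_term[of c i K] c(3) by blast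
  \<comment> \<open>Positivity of \<open>a j\<close> puts the placeholder 0 into the early
    alternative.\<close>
  have "0 < a j" using a_ge[of j] D_pos[of j] by linarith
  then have dich: "p < 2 * a j \<or> a (Suc j) \<le> p" if "p = 0 \<or> (\<exists>l\<ge>k. p \<in> block l)" for p
    using that block_dichotomy by auto
  have "int (D j) \<le> \<bar>int p' ^ C - int p ^ C + comb c K\<bar>"
    using j(3,4,2) c(1) dich[OF p] dich[OF p'] by (rule leading_term_dominates)
  moreover have "k \<le> j" using c(2) j(3) not_less by blast
  ultimately show ?thesis using D_le[of k j] by linarith
qed

text \<open>What is left of a representation once everything chosen before stage \<open>k\<close> is
  dropped; \<open>p = 0\<close> stands for a deleted power from an earlier block.\<close>

definition sparse_sums :: "nat \<Rightarrow> int set" where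
  "sparse_sums k = {int p ^ C + comb c K | p c K. (p = 0 \<or> (\<exists>l\<ge>k. p \<in> block l)) \<and>
     (\<forall>j. \<bar>c j\<bar> \<le> int (J j)) \<and> (\<forall>j<k. c j = 0) \<and> (\<forall>j\<ge>K. c j = 0)}"

text \<open>Differences of two such sums have coefficients up to \<open>2 * J j\<close>, hence the
  factor 2 in \<open>separated\<close> and \<open>leading_term_dominates\<close>.\<close>

lemma sparse_sums_separated:
  assumes "v \<in> sparse_sums k" "v' \<in> sparse_sums k" "v \<noteq> v'"
  shows "int (D k) \<le> \<bar>v' - v\<bar>"
proof -
  obtain p c K where v: "v = int p ^ C + comb c K" "p = 0 \<or> (\<exists>l\<ge>k. p \<in> block l)"
    and c: "\<And>j. \<bar>c j\<bar> \<le> int (J j)" "\<And>j. j < k \<Longrightarrow> c j = 0" "\<And>j. K \<le> j \<Longrightarrow> c j = 0"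
    using assms(1) unfolding sparse_sums_def by blast
  obtain p' c' K' where v': "v' = int p' ^ C + comb c' K'" "p' = 0 \<or> (\<exists>l\<ge>k. p' \<in> block l)"
    and c': "\<And>j. \<bar>c' j\<bar> \<le> int (J j)" "\<And>j. j < k \<Longrightarrow> c' j = 0" "\<And>j. K' \<le> j \<Longrightarrow> c' j = 0"
    using assms(2) unfolding sparse_sums_def by blast
  define L where "L = max K K'"
  have "comb c L = comb c K" "comb c' L = comb c' K'"
    using c(3) c'(3) by (auto simp: L_def intro!: comb_extend)
  then have eq: "v' - v = int p' ^ C - int p ^ C + comb (\<lambda>j. c' j - c j) L"
    by (simp add: v v' comb_diff[symmetric])
  show ?thesis
    unfolding eq
  proof (rule separated)
    show "\<bar>c' j - c j\<bar> \<le> int (2 * J j)" for j using c(1)[of j] c'(1)[of j] by simp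
    show "c' j - c j = 0" if "j < k" for j using c(2) c'(2) that by simp
    show "c' j - c j = 0" if "L \<le> j" for j using c(3) c'(3) that by (simp add: L_def)
    show "int p' ^ C - int p ^ C + comb (\<lambda>j. c' j - c j) L \<noteq> 0"
      using assms(3) eq by linarith
  qed (use v v' in auto)
qed

text \<open>Dropping the coefficients below \<open>k\<close> moves the sum by at most
  \<open>M k\<close>, and replacing a power from an earlier block by 0 moves it by at most
  \<open>M k\<close> again.\<close>

lemma pt_pos_near_sparse:
  assumes "0 < pt m"
  shows "\<exists>v\<in>sparse_sums k. \<bar>m - v\<bar> \<le> 2 * int (M k)"
proof -
  obtain p c K where rep: "represents m p c K" and c: "\<And>j. \<bar>c j\<bar> \<le> int (J j)"
    using pt_pos_represents[OF assms] by blast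
  define d where "d = (\<lambda>j. if j < k then 0 else c j)"
  define r where "r = (if p \<in> (\<Union>l\<in>{k..}. block l) then p else 0)"
  define L where "L = max K k"
  have zero: "c j = 0" if "K \<le> j" for j using rep that by (simp add: represents_def)
  have "comb c K = comb c L"
    using zero by (intro comb_extend[symmetric]) (auto simp: L_def)
  moreover have "comb c L - comb d L = comb (\<lambda>j. c j - d j) L" by (rule comb_diff)
  moreover have "comb (\<lambda>j. c j - d j) L = comb (\<lambda>j. c j - d j) k"
    by (rule comb_extend) (auto simp: L_def d_def)
  moreover have "\<bar>comb (\<lambda>j. c j - d j) k\<bar> \<le> int (1 * M k)"
    by (rule abs_comb_le) (use c in \<open>auto simp: d_def\<close>)
  ultimately have "\<bar>comb c K - comb d L\<bar> \<le> int (M k)" by simp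
  moreover have "\<bar>int p ^ C - int r ^ C\<bar> \<le> int (M k)"
  proof (cases "p \<in> (\<Union>l\<in>{k..}. block l)")
    case False
    then obtain l where "l < k" "p \<in> block l"
      using rep not_less by (auto simp: represents_def)
    then have "p ^ C \<le> (2 * a l) ^ C" by (intro power_mono) (auto simp: block_def)
    also have "\<dots> \<le> M k" using \<open>l < k\<close> by (rule power_block_le_M)
    finally have "int p ^ C \<le> int (M k)" by (metis of_nat_le_iff of_nat_power)
    moreover have "int r ^ C = 0" unfolding r_def if_not_P[OF False] using C_ge by simp
    moreover have "0 \<le> int p ^ C" by simp
    ultimately show ?thesis by linarith
  qed (simp add: r_def)
  moreover have "m = int p ^ C + comb c K" using rep by (simp add: represents_def)
  ultimately have "\<bar>m - (int r ^ C + comb d L)\<bar> \<le> 2 * int (M k)" by linarith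
  moreover have "int r ^ C + comb d L \<in> sparse_sums k"
  proof -
    have "r = 0 \<or> (\<exists>l\<ge>k. r \<in> block l)" by (auto simp: r_def)
    moreover have "\<forall>j. \<bar>d j\<bar> \<le> int (J j)" "\<forall>j<k. d j = 0" "\<forall>j\<ge>L. d j = 0"
      using c zero by (auto simp: d_def L_def)
    ultimately show ?thesis unfolding sparse_sums_def by blast
  qed
  ultimately show ?thesis by blast
qed

text \<open>Assign to each such \<open>i\<close> its offset from a nearby sparse sum. Equal offsets
  make two sparse sums differ by less than \<open>D k\<close>, so these agree and so do the indices;
  only \<open>4 * M k + 1\<close> offsets are possible.\<close>

lemma card_pt_pos_window: "card {i. i < D k \<and> 0 < pt (m + int i)} \<le> 4 * M k + 1"
proof -
  let ?E = "{i. i < D k \<and> 0 < pt (m + int i)}"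
  have "\<forall>i\<in>?E. \<exists>v\<in>sparse_sums k. \<bar>m + int i - v\<bar> \<le> 2 * int (M k)"
    using pt_pos_near_sparse by blast
  then obtain v where "\<forall>i\<in>?E. v i \<in> sparse_sums k \<and> \<bar>m + int i - v i\<bar> \<le> 2 * int (M k)"
    unfolding Bex_def by (rule bchoice[THEN exE])
  then have v: "v i \<in> sparse_sums k" "\<bar>m + int i - v i\<bar> \<le> 2 * int (M k)" if "i \<in> ?E" for i
    using that by blast+
  have "card ?E \<le> card {- (2 * int (M k))..2 * int (M k)}"
  proof (rule card_inj_on_le)
    show "inj_on (\<lambda>i. m + int i - v i) ?E"
    proof (rule inj_onI)
      fix i i' assume i: "i \<in> ?E" "i' \<in> ?E" and "m + int i - v i = m + int i' - v i'"
      then have eq: "v i' - v i = int i' - int i" by simp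
      have "\<bar>int i' - int i\<bar> < int (D k)"
        using i unfolding mem_Collect_eq by linarith
      then have "v i = v i'" using sparse_sums_separated[OF v(1)[OF i(1)] v(1)[OF i(2)]] eq by linarith
      then show "i = i'" using eq by simp
    qed
    show "(\<lambda>i. m + int i - v i) ` ?E \<subseteq> {- (2 * int (M k))..2 * int (M k)}"
    proof (rule image_subsetI)
      fix i assume "i \<in> ?E"
      from v(2)[OF this] show "m + int i - v i \<in> {- (2 * int (M k))..2 * int (M k)}"
        unfolding atLeastAtMost_iff by linarith
    qed
  qed simp
  then show ?thesis by simp
qed

lemma sum_pt_window: "(\<Sum>i<D k. pt (m + int i)) \<le> real (4 * M k + 1)"
proof -
  have "(\<Sum>i<D k. pt (m + int i)) \<le> (\<Sum>i<D k. if 0 < pt (m + int i) then 1 else 0)"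
    by (rule sum_mono) (use pt_le_1 pt_nonneg in \<open>auto simp: not_less\<close>)
  also have "\<dots> = real (card {i. i < D k \<and> 0 < pt (m + int i)})"
    by (simp add: sum.If_cases lessThan_def Int_def)
  also have "\<dots> \<le> real (4 * M k + 1)"
    using card_pt_pos_window by (intro of_nat_mono) simp
  finally show ?thesis .
qed

section \<open>Oscillation of the averages along powers\<close>

lemma pt_power_before_block:
  assumes "i < a k" "0 < pt (int i ^ C)"
  shows "i \<le> 2 * M k"
proof -
  obtain p c K where rep: "represents (int i ^ C) p c K" and c: "\<And>j. \<bar>c j\<bar> \<le> int (J j)"
    using pt_pos_represents[OF assms(2)] by blast
  then obtain l where p: "p \<in> block l" and zero: "\<And>j. K \<le> j \<Longrightarrow> c j = 0"
    and eq: "int i ^ C = int p ^ C + comb c K"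
    by (auto simp: represents_def)
  \<comment> \<open>A leading coefficient of index at least \<open>k\<close> would keep
    \<open>int p ^ C - int i ^ C + comb c K\<close> away from 0, because \<open>i < a k\<close>
    counts as early.\<close>
  have small: "c j = 0" if "k \<le> j" for j
  proof (rule ccontr)
    assume "c j \<noteq> 0"
    then obtain j' where j': "j \<le> j'" "j' < K" "c j' \<noteq> 0" "\<And>i. j' < i \<Longrightarrow> c i = 0"
      using obtain_leading_term[of c j K] zero by blast
    have "i < 2 * a j'" using assms(1) a_le[of k j'] that j'(1) by linarith
    moreover have "\<bar>c i\<bar> \<le> int (2 * J i)" for i using c[of i] by linarith
    ultimately have "int (D j') \<le> \<bar>int p ^ C - int i ^ C + comb c K\<bar>"
      using j' block_dichotomy[OF p] by (intro leading_term_dominates) auto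
    then show False using eq D_pos[of j'] by simp
  qed
  have "comb c K = comb c (max K k)" using zero by (intro comb_extend[symmetric]) auto
  also have "\<dots> = comb c k" using small by (intro comb_extend) auto
  finally have "comb c K = comb c k" .
  moreover have "\<bar>comb c k\<bar> \<le> int (1 * M k)" using c by (intro abs_comb_le) auto
  ultimately have bound: "\<bar>comb c K\<bar> \<le> int (M k)" by simp
  \<comment> \<open>For \<open>p\<close> in a block from \<open>k\<close> on,
    \<open>p ^ C - i ^ C\<close> is at least \<open>p > M k\<close>, more than the combination can
    cancel.\<close>
  have "l < k"
  proof (rule ccontr)
    assume "\<not> l < k"
    then have "a k \<le> p" using p a_le[of k l] by (auto simp: block_def)
    then have "int i ^ C + int p \<le> int p ^ C" using assms(1) by (intro power_diff_ge[OF C_ge]) auto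
    moreover have "M k < p" using \<open>a k \<le> p\<close> a_ge[of k] D_pos[of k] by linarith
    ultimately show False using eq bound by linarith
  qed
  have "p ^ C \<le> (2 * a l) ^ C" using p by (intro power_mono) (auto simp: block_def)
  also have "\<dots> \<le> M k" using \<open>l < k\<close> by (rule power_block_le_M)
  finally have "int p ^ C \<le> int (M k)" by (metis of_nat_le_iff of_nat_power)
  then have "int i ^ C \<le> 2 * int (M k)" using eq bound by linarith
  also have "\<dots> = int (2 * M k)" by simp
  finally have "i ^ C \<le> 2 * M k" by (metis of_nat_le_iff of_nat_power)
  then show ?thesis using le_power_C[of i] by linarith
qed

lemma a_pos: "0 < a k"
  using a_ge[of k] D_pos[of k] by linarith

lemma average_low: "1 / real (a k) * (\<Sum>i<a k. pt (int i ^ C)) \<le> 1 / 4"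
proof -
  have "(\<Sum>i<a k. pt (int i ^ C)) \<le> (\<Sum>i<a k. if i < 2 * M k + 1 then 1 else 0)"
  proof (rule sum_mono)
    fix i assume "i \<in> {..<a k}"
    then show "pt (int i ^ C) \<le> (if i < 2 * M k + 1 then 1 else 0)"
      using pt_power_before_block[of i k] pt_le_1[of "int i ^ C"] by (auto simp: not_less[symmetric])
  qed
  also have "\<dots> = real (card ({..<a k} \<inter> {..<2 * M k + 1}))"
    by (simp add: sum.If_cases lessThan_def)
  also have "\<dots> \<le> real (card {..<2 * M k + 1})"
    by (intro of_nat_mono card_mono) auto
  finally have "(\<Sum>i<a k. pt (int i ^ C)) \<le> real (2 * M k + 1)" by simp
  \<comment> \<open>The summand 8 in \<open>D_ge\<close> ensures that the at most
    \<open>2 * M k + 1\<close> nonzero terms are at most a quarter of all \<open>a k\<close>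
    terms.\<close>
  moreover have "4 * (2 * M k + 1) \<le> a k"
  proof -
    have "8 * (4 * M k + 1) \<le> (k + 8) * (4 * M k + 1)" by (intro mult_right_mono) auto
    also have "\<dots> \<le> D k" by (rule D_ge)
    finally show ?thesis using a_ge[of k] by simp
  qed
  ultimately show ?thesis using a_pos[of k] by (simp add: divide_simps)
qed

text \<open>The upper half of the range is \<open>block k\<close>, where every power has value
  1.\<close>

lemma average_high: "1 / 2 \<le> 1 / real (2 * a k) * (\<Sum>i<2 * a k. pt (int i ^ C))"
proof -
  have "real (a k) = (\<Sum>i\<in>block k. pt (int i ^ C))"
    by (simp add: pt_power_block block_def)
  also have "\<dots> \<le> (\<Sum>i<2 * a k. pt (int i ^ C))"
    by (rule sum_mono2) (auto simp: block_def pt_nonneg)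
  finally show ?thesis using a_pos[of k] by (simp add: divide_simps)
qed

lemma a_tendsto: "filterlim a at_top sequentially"
proof (rule filterlim_at_top_mono[OF filterlim_ident])
  have "k \<le> a k" for k
  proof -
    have "k * 1 \<le> (k + 8) * (4 * M k + 1)" by (intro mult_mono) auto
    also have "\<dots> \<le> D k" by (rule D_ge)
    finally show ?thesis using a_ge[of k] by linarith
  qed
  then show "\<forall>\<^sub>F k in sequentially. k \<le> a k" by simp
qed

lemma not_convergent_power_averages:
  "\<not> convergent (\<lambda>n. 1 / real n * (\<Sum>i<n. pt (int i ^ C)))"
proof
  assume "convergent (\<lambda>n. 1 / real n * (\<Sum>i<n. pt (int i ^ C)))"
  then obtain L where L: "(\<lambda>n. 1 / real n * (\<Sum>i<n. pt (int i ^ C))) \<longlonglongrightarrow> L"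
    by (auto simp: convergent_def)
  have "filterlim (\<lambda>k. 2 * a k) at_top sequentially"
    by (rule filterlim_at_top_mono[OF a_tendsto]) simp
  from filterlim_compose[OF L this] have "1 / 2 \<le> L"
    by (rule LIMSEQ_le_const) (blast intro: average_high)
  moreover from filterlim_compose[OF L a_tendsto] have "L \<le> 1 / 4"
    by (rule LIMSEQ_le_const2) (blast intro: average_low)
  ultimately show False by simp
qed

end

section \<open>Compactness of the cube and choice of the scales\<close>

lemma compact_unit_functions: "compact {y :: int \<Rightarrow> real. \<forall>i. 0 \<le> y i \<and> y i \<le> 1}"
proof -
  have "compactin (product_topology (\<lambda>_::int. euclideanreal) UNIV) (PiE UNIV (\<lambda>_. {0..1}))"
    by (simp add: compactin_PiE)
  then have "compact (PiE UNIV (\<lambda>_::int. {0..1::real}))"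
    by (simp add: euclidean_product_topology)
  then show ?thesis by (simp add: PiE_def Pi_def)
qed

text \<open>\<open>M\<close> is the only state of the recursion: the other scales at stage
  \<open>k\<close> are functions of \<open>k\<close> and \<open>M k\<close>. The prime
  \<open>q'\<close> is picked before \<open>J'\<close>, which may therefore depend on
  \<open>h\<close> at that prime.\<close>

lemma exists_scales:
  fixes h :: "nat \<Rightarrow> real"
  assumes "2 \<le> C" and h: "\<And>n. 0 < n \<Longrightarrow> 0 < h n"
  shows "\<exists>a q J M D. scales C a q J M D \<and> (\<forall>k. prime (q k)) \<and>
    (\<forall>k. 1 / real (J k) \<le> h (q k) / real (Suc k))"
proof -
  define D' :: "nat \<Rightarrow> nat \<Rightarrow> nat" where "D' k m = (k + 8) * (4 * m + 1)" for k m
  define a' where "a' k m = 2 * m + D' k m" for k m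
  define q' where "q' k m = (SOME p. prime p \<and> (2 * a' k m) ^ C + 2 * m + D' k m < p)" for k m
  \<comment> \<open>The factor \<open>Suc k\<close> turns a bound by \<open>h\<close> into little
    o.\<close>
  define J' where "J' k m = nat \<lceil>real (Suc k) / h (q' k m)\<rceil>" for k m
  define M where "M = rec_nat 0 (\<lambda>k m. m + J' k m * q' k m + (2 * a' k m) ^ C)"
  have M_Suc: "M (Suc k) = M k + J' k (M k) * q' k (M k) + (2 * a' k (M k)) ^ C" for k
    by (simp add: M_def)
  have q': "prime (q' k m) \<and> (2 * a' k m) ^ C + 2 * m + D' k m < q' k m" for k m
    unfolding q'_def by (rule someI_ex) (rule bigger_prime)
  have ratio: "0 < real (Suc k) / h (q' k m)" for k m
    using q'[of k m] h prime_gt_0_nat by simp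
  have J_pos: "0 < J' k m" for k m
    using ratio[of k m] unfolding J'_def by linarith
  show ?thesis
  proof (intro exI conjI allI)
    show "scales C (\<lambda>k. a' k (M k)) (\<lambda>k. q' k (M k)) (\<lambda>k. J' k (M k)) M (\<lambda>k. D' k (M k))"
    proof
      show "D' k (M k) \<le> D' (Suc k) (M (Suc k))" for k
        unfolding D'_def by (intro mult_mono) (auto simp: M_Suc)
      show "(2 * a' k (M k)) ^ C + 2 * M k + D' k (M k) \<le> q' k (M k)" for k
        using q'[of k "M k"] by linarith
    qed (use assms J_pos in \<open>auto simp: M_Suc D'_def a'_def\<close>)
    show "prime (q' k (M k))" for k using q' by blast
    show "1 / real (J' k (M k)) \<le> h (q' k (M k)) / real (Suc k)" for k
    proof -
      have "real (Suc k) / h (q' k (M k)) \<le> real (J' k (M k))"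
        unfolding J'_def by linarith
      moreover have "0 < h (q' k (M k))" using q' h prime_gt_0_nat by blast
      ultimately show ?thesis using J_pos[of k "M k"] by (simp add: field_simps)
    qed
  qed
qed

section \<open>The phase space and its properties\<close>

context scales
begin

text \<open>Closed translation-invariant conditions satisfied by \<open>pt\<close> take the place of
  its orbit closure; the zero function satisfies them too and carries the invariant measure.\<close>

definition phase_space :: "(int \<Rightarrow> real) set" where
  "phase_space = {y. (\<forall>i. 0 \<le> y i \<and> y i \<le> 1) \<and> (\<forall>i k. \<bar>y (i + int (q k)) - y i\<bar> \<le> 1 / real (J k)) \<and>
     (\<forall>m k. (\<Sum>i<D k. y (m + int i)) \<le> real (4 * M k + 1))}"

lemma compact_phase_space: "compact phase_space"
proof -
  have cont [continuous_intros]: "continuous_on UNIV (\<lambda>y :: int \<Rightarrow> real. y i)" for i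
    by (rule continuous_on_product_coordinates)
  have "closed {y :: int \<Rightarrow> real. (\<forall>i k. \<bar>y (i + int (q k)) - y i\<bar> \<le> 1 / real (J k)) \<and>
     (\<forall>m k. (\<Sum>i<D k. y (m + int i)) \<le> real (4 * M k + 1))}"
    by (intro closed_Collect_conj closed_Collect_all closed_Collect_le continuous_intros)
  from compact_Int_closed[OF compact_unit_functions this] show ?thesis
    by (simp add: phase_space_def Collect_conj_eq[symmetric])
qed

lemma translate_in_phase_space: "y \<in> phase_space \<Longrightarrow> (\<lambda>i. y (i + k)) \<in> phase_space"
proof -
  assume y: "y \<in> phase_space"
  have "\<bar>y (i + int (q j) + k) - y (i + k)\<bar> \<le> 1 / real (J j)" for i j
  proof -
    have "\<bar>y (i + k + int (q j)) - y (i + k)\<bar> \<le> 1 / real (J j)"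
      using y unfolding phase_space_def by blast
    then show ?thesis by (simp only: add.assoc add.commute[of "int (q j)"])
  qed
  moreover have "(\<Sum>i<D j. y (m + int i + k)) \<le> real (4 * M j + 1)" for m j
  proof -
    have "(\<Sum>i<D j. y (m + k + int i)) \<le> real (4 * M j + 1)"
      using y unfolding phase_space_def by blast
    then show ?thesis by (simp only: add.assoc add.commute[of k])
  qed
  ultimately show ?thesis using y unfolding phase_space_def by blast
qed

lemma zero_in_phase_space: "(\<lambda>_. 0) \<in> phase_space"
  by (simp add: phase_space_def)

lemma pt_in_phase_space: "pt \<in> phase_space"
  using pt_nonneg pt_le_1 pt_translate sum_pt_window unfolding phase_space_def by blast

lemma totally_uniquely_ergodic_phase_space:
  "totally_uniquely_ergodic (submetric euclidean_metric phase_space) left_shift"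
proof (rule totally_uniquely_ergodic_shift[OF translate_in_phase_space zero_in_phase_space])
  fix e :: real assume "0 < e"
  \<comment> \<open>The growing factor \<open>k + 8\<close> in \<open>D_ge\<close> brings the
    density bound \<open>(4 * M k + 1) / D k\<close> down to any given \<open>e\<close>.\<close>
  obtain k :: nat where "1 / e < real k" using reals_Archimedean2 by blast
  then have k: "1 \<le> e * real (k + 8)"
    using \<open>0 < e\<close> by (simp add: field_simps)
  have "real (4 * M k + 1) * 1 \<le> real (4 * M k + 1) * (e * real (k + 8))"
    using k by (intro mult_left_mono) auto
  also have "\<dots> = e * real ((k + 8) * (4 * M k + 1))" by (simp add: algebra_simps)
  also have "\<dots> \<le> e * real (D k)"
    using \<open>0 < e\<close> D_ge[of k] by (intro mult_left_mono of_nat_mono) auto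
  finally have le: "real (4 * M k + 1) \<le> e * real (D k)" by simp
  have "(\<Sum>i<D k. y (int i)) \<le> e * real (D k)" if "y \<in> phase_space" for y
  proof -
    have "(\<Sum>i<D k. y (0 + int i)) \<le> real (4 * M k + 1)"
      using that unfolding phase_space_def by blast
    then show ?thesis using le by simp
  qed
  then show "\<exists>D>0. \<forall>y\<in>phase_space. (\<Sum>i<D. y (int i)) \<le> e * real D"
    using D_pos[of k] by blast
qed (simp_all add: phase_space_def)

text \<open>Nonnegativity, witnessed by the fixed point 0, lets the norm be removed in the little-o
  estimate.\<close>

lemma displacement_bounds:
  defines "X \<equiv> submetric euclidean_metric phase_space"
  shows "0 \<le> (SUP x\<in>mspace X. mdist X x ((left_shift ^^ q k) x))"
    and "(SUP x\<in>mspace X. mdist X x ((left_shift ^^ q k) x)) \<le> 2 / real (J k)"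
proof -
  have le: "dist y ((left_shift ^^ q k) y) \<le> 2 / real (J k)" if "y \<in> phase_space" for y
  proof -
    have "\<bar>y i - (left_shift ^^ q k) y i\<bar> \<le> 1 / real (J k)" for i
      using that unfolding phase_space_def funpow_left_shift by (simp add: abs_minus_commute)
    from dist_fun_le[OF this] show ?thesis by simp
  qed
  show "(SUP x\<in>mspace X. mdist X x ((left_shift ^^ q k) x)) \<le> 2 / real (J k)"
    unfolding X_def using zero_in_phase_space le by (auto intro!: cSUP_least)
  have "dist (\<lambda>_. 0) ((left_shift ^^ q k) (\<lambda>_. 0)) \<le> (SUP x\<in>phase_space. dist x ((left_shift ^^ q k) x))"
    by (rule cSUP_upper[OF zero_in_phase_space]) (rule bdd_aboveI2[OF le])
  then show "0 \<le> (SUP x\<in>mspace X. mdist X x ((left_shift ^^ q k) x))"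
    unfolding X_def by (simp add: order_trans[OF zero_le_dist])
qed

end

(* Every compact metric space has at most continuum many points, so it is isometric to one
   whose carrier is a subset of the type int => real; fixing this type loses no generality.
   The metric of X is unrelated to any structure on int => real. *)
theorem theorem10:
  fixes C :: nat and h :: "nat \<Rightarrow> real"
  assumes "C \<ge> 2"
    and "\<And>n. n > 0 \<Longrightarrow> h n > 0"
  shows "\<exists>(X :: (int \<Rightarrow> real) metric) (T :: (int \<Rightarrow> real) \<Rightarrow> (int \<Rightarrow> real)) (q :: nat \<Rightarrow> nat).
           topological_dynamical_system X T \<and>
           totally_uniquely_ergodic X T \<and>
           (\<forall>n. prime (q n)) \<and>
           (\<lambda>n. SUP x\<in>mspace X. mdist X x ((T ^^ q n) x)) \<in> o(\<lambda>n. h (q n)) \<and>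
           (\<exists>(f :: (int \<Rightarrow> real) \<Rightarrow> real) x.
              continuous_map (mtopology_of X) euclideanreal f \<and> x \<in> mspace X \<and>
              \<not> convergent (\<lambda>n. (1 / real n) * (\<Sum>i<n. f ((T ^^ (i ^ C)) x))))"
proof -
  obtain a q J M D where "scales C a q J M D" and prime: "\<And>k. prime (q k)"
    and J: "\<And>k. 1 / real (J k) \<le> h (q k) / real (Suc k)"
    using exists_scales[of C h, OF assms] by metis
  interpret scales C a q J M D by fact
  let ?X = "submetric euclidean_metric phase_space"
  let ?d = "\<lambda>n. SUP x\<in>mspace ?X. mdist ?X x ((left_shift ^^ q n) x)"
  have rate: "?d \<in> o(\<lambda>n. h (q n))"
  proof (rule landau_o.smallI)
    fix c :: real assume "0 < c"
    obtain N :: nat where N: "2 / c < real N" using reals_Archimedean2 by blast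
    have "norm (?d n) \<le> c * norm (h (q n))" if "N \<le> n" for n
    proof -
      have h_pos: "0 < h (q n)" using assms(2) prime prime_gt_0_nat by blast
      have "2 / c < real (Suc n)" using N that by linarith
      then have "2 / real (Suc n) \<le> c" using \<open>0 < c\<close> by (simp add: field_simps)
      then have "2 / real (Suc n) * h (q n) \<le> c * h (q n)"
        using h_pos by (intro mult_right_mono) auto
      moreover have "2 / real (J n) \<le> 2 / real (Suc n) * h (q n)"
        using mult_left_mono[OF J[of n], of 2] by simp
      ultimately have "?d n \<le> c * h (q n)" using displacement_bounds(2)[of n] by linarith
      then show ?thesis
        unfolding real_norm_def abs_of_nonneg[OF displacement_bounds(1)] abs_of_pos[OF h_pos] .
    qed
    then show "\<forall>\<^sub>F n in sequentially. norm (?d n) \<le> c * norm (h (q n))"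
      by (rule eventually_sequentiallyI)
  qed
  \<comment> \<open>Evaluation at 0 reads off \<open>pt (int i ^ C)\<close> from \<open>pt\<close>
    shifted \<open>i ^ C\<close> times.\<close>
  have f: "continuous_map (mtopology_of ?X) euclideanreal (\<lambda>y. y 0)"
    unfolding mtopology_of_submetric mtopology_of_euclidean
    by (auto intro: continuous_on_subset[OF continuous_on_product_coordinates])
  have "\<not> convergent (\<lambda>n. (1 / real n) * (\<Sum>i<n. ((left_shift ^^ (i ^ C)) pt) 0))"
    using not_convergent_power_averages by (simp add: funpow_left_shift)
  moreover have "pt \<in> mspace ?X" using pt_in_phase_space by simp
  ultimately have
    "\<exists>(f :: (int \<Rightarrow> real) \<Rightarrow> real) x. continuous_map (mtopology_of ?X) euclideanreal f \<and> x \<in> mspace ?X \<and>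
       \<not> convergent (\<lambda>n. (1 / real n) * (\<Sum>i<n. f ((left_shift ^^ (i ^ C)) x)))"
    by (intro exI[of _ "\<lambda>y. y 0"] exI[of _ pt] conjI f)
  moreover have "topological_dynamical_system ?X left_shift"
    by (rule topological_dynamical_system_shift[OF compact_phase_space translate_in_phase_space])
  ultimately show ?thesis
    using totally_uniquely_ergodic_phase_space prime rate
    by (intro exI[of _ ?X] exI[of _ left_shift] exI[of _ q] conjI allI)
qed

end
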